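(* Let $G$ be a finite simple graph with girth $g \ge 5$ and minimum degree $\delta \ge 2$. Then $2\delta - 2 \le Z(G)$.
   Context: The girth of $G$ is the length of a shortest cycle in $G$. Zero forcing process: start with an initial set $S$ of colored vertices. A colored vertex $v$ forces an uncolored neighbor $w$ (making $w$ colored) if $w$ is the only uncolored neighbor of $v$; forces are applied repeatedly. $S$ is a zero forcing set if eventually every vertex becomes colored. $Z(G)$ is the minimum size of a zero forcing set. *)

theory Defs
  imports "Graph_Theory.Graph_Theory" "HOL-Library.Extended_Nat"
begin

text \<open>
  The locale \<^locale>\<open>graph\<close> represents an undirected edge by two antiparallel arcs, so
  \<^const>\<open>pre_digraph.cycle\<close> also admits the closed walk \<open>u, v, u\<close> of length 2 along a single
  edge. The bound \<open>3 \<le> length p\<close> leaves exactly the cycles of the undirected graph.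
  The girth of an acyclic graph is \<open>\<infinity>\<close>.
\<close>

definition girth :: "('a, 'b) pre_digraph \<Rightarrow> enat" where
  "girth G = (INF p \<in> {p. pre_digraph.cycle G p \<and> 3 \<le> length p}. enat (length p))"

definition min_degree :: "('a, 'b) pre_digraph \<Rightarrow> nat" where
  "min_degree G = Min (out_degree G ` verts G)"

definition forces :: "('a, 'b) pre_digraph \<Rightarrow> 'a set \<Rightarrow> 'a \<Rightarrow> 'a \<Rightarrow> bool" where
  "forces G S v w \<longleftrightarrow> v \<in> S \<and> {u. v \<rightarrow>\<^bsub>G\<^esub> u \<and> u \<notin> S} = {w}"

definition force_step :: "('a, 'b) pre_digraph \<Rightarrow> 'a set \<Rightarrow> 'a set \<Rightarrow> bool" where
  "force_step G S T \<longleftrightarrow> (\<exists>v w. forces G S v w \<and> T = insert w S)"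

definition zero_forcing_set :: "('a, 'b) pre_digraph \<Rightarrow> 'a set \<Rightarrow> bool" where
  "zero_forcing_set G S \<longleftrightarrow> S \<subseteq> verts G \<and> (force_step G)\<^sup>*\<^sup>* S (verts G)"

definition zero_forcing_number :: "('a, 'b) pre_digraph \<Rightarrow> nat" where
  "zero_forcing_number G = Min (card ` {S. zero_forcing_set G S})"

end

theory Submission
  imports Defs
begin

text \<open>
  Let \<open>v\<^sub>1\<close> and \<open>v\<^sub>2\<close> be the vertices performing the first two forces from a zero forcing set \<open>S\<close>.
  They are distinct, and their closed neighbourhoods are contained in \<open>S\<close> together with the
  two forced vertices, so \<open>S\<close> has at least \<open>\<bar>N[v\<^sub>1] \<union> N[v\<^sub>2]\<bar> - 2\<close> elements. This union has at
  least \<open>2\<delta>\<close> elements: if \<open>v\<^sub>1\<close> and \<open>v\<^sub>2\<close> are adjacent, their open neighbourhoods are disjoint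
  because there are no triangles; otherwise they have at most one common neighbour because there
  are no 4-cycles. If fewer than two forces occur, \<open>S\<close> misses at most one vertex, and the same
  estimate for any two vertices applies.
\<close>

definition nbhd :: "('a, 'b) pre_digraph \<Rightarrow> 'a \<Rightarrow> 'a set" where
  "nbhd G v = {u. v \<rightarrow>\<^bsub>G\<^esub> u}"

lemma mem_nbhd_iff [simp]: "u \<in> nbhd G v \<longleftrightarrow> v \<rightarrow>\<^bsub>G\<^esub> u"
  by (simp add: nbhd_def)

text \<open>Trades the singleton condition for an inclusion, from which cardinality bounds follow by
  monotonicity.\<close>

lemma forces_iff:
  "forces G S v w \<longleftrightarrow> v \<in> S \<and> v \<rightarrow>\<^bsub>G\<^esub> w \<and> w \<notin> S \<and> nbhd G v \<subseteq> insert w S"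
  unfolding forces_def set_eq_iff nbhd_def by blast

lemma girth_le_cycle_length:
  assumes "pre_digraph.cycle G p" "3 \<le> length p"
  shows "girth G \<le> enat (length p)"
  unfolding girth_def using assms by (intro INF_lower) simp

context wf_digraph
begin

lemma nbhd_subset_verts: "nbhd G v \<subseteq> verts G"
  by (auto dest: adj_in_verts)

lemma girth_le_3_of_triangle:
  assumes "a \<rightarrow>\<^bsub>G\<^esub> b" "b \<rightarrow>\<^bsub>G\<^esub> c" "c \<rightarrow>\<^bsub>G\<^esub> a" "distinct [a, b, c]"
  shows "girth G \<le> 3"
proof -
  \<comment> \<open>A \<open>cycle\<close> is a list of arcs, so each adjacency is first replaced by
    an arc witnessing it.\<close>
  from assms obtain e f g where
    "e \<in> arcs G" "tail G e = a" "head G e = b"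
    "f \<in> arcs G" "tail G f = b" "head G f = c"
    "g \<in> arcs G" "tail G g = c" "head G g = a"
    by (elim reachableE)
  then have "cycle [e, f, g]"
    using assms by (auto simp: cycle_def awalk_simps intro!: exI[of _ a])
  from girth_le_cycle_length[OF this] show ?thesis
    by (simp add: numeral_eq_enat eval_nat_numeral)
qed

lemma girth_le_4_of_quadrilateral:
  assumes "a \<rightarrow>\<^bsub>G\<^esub> b" "b \<rightarrow>\<^bsub>G\<^esub> c" "c \<rightarrow>\<^bsub>G\<^esub> d" "d \<rightarrow>\<^bsub>G\<^esub> a" "distinct [a, b, c, d]"
  shows "girth G \<le> 4"
proof -
  from assms obtain e f g h where
    "e \<in> arcs G" "tail G e = a" "head G e = b"
    "f \<in> arcs G" "tail G f = b" "head G f = c"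
    "g \<in> arcs G" "tail G g = c" "head G g = d"
    "h \<in> arcs G" "tail G h = d" "head G h = a"
    by (elim reachableE)
  then have "cycle [e, f, g, h]"
    using assms by (auto simp: cycle_def awalk_simps intro!: exI[of _ a])
  from girth_le_cycle_length[OF this] show ?thesis
    by (simp add: numeral_eq_enat eval_nat_numeral)
qed

end

context fin_digraph
begin

lemma finite_nbhd [simp]: "finite (nbhd G v)"
  using nbhd_subset_verts finite_verts by (rule finite_subset)

lemma min_degree_le_out_degree: "v \<in> verts G \<Longrightarrow> min_degree G \<le> out_degree G v"
  unfolding min_degree_def by simp

lemma finite_zero_forcing_sets: "finite {S. zero_forcing_set G S}"
  by (rule finite_subset[of _ "Pow (verts G)"]) (auto simp: zero_forcing_set_def)

lemma zero_forcing_number_geI: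
  assumes "\<And>S. zero_forcing_set G S \<Longrightarrow> n \<le> card S"
  shows "n \<le> zero_forcing_number G"
proof -
  \<comment> \<open>\<open>Min\<close> needs a nonempty set; \<open>verts G\<close> is zero forcing
    with no force at all.\<close>
  have "zero_forcing_set G (verts G)"
    by (simp add: zero_forcing_set_def)
  then show ?thesis
    unfolding zero_forcing_number_def using assms finite_zero_forcing_sets
    by (subst Min_ge_iff) auto
qed

end

text \<open>Degrees count arcs, neighbourhoods count vertices; without parallel arcs,
  \<open>head G\<close> is injective on the arcs leaving \<open>v\<close>.\<close>

lemma (in digraph) out_degree_eq_card_nbhd: "out_degree G v = card (nbhd G v)"
proof -
  have "inj_on (head G) (out_arcs G v)"
    by (auto intro!: inj_onI no_multi_arcs simp: arc_to_ends_def)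
  moreover have "head G ` out_arcs G v = nbhd G v"
    by (auto simp: arcs_ends_conv out_arcs_def)
  ultimately show ?thesis
    unfolding out_degree_def using card_image by metis
qed

context graph
begin

lemma adj_sym: "u \<rightarrow>\<^bsub>G\<^esub> v \<Longrightarrow> v \<rightarrow>\<^bsub>G\<^esub> u"
  using sym_arcs by (rule arcs_ends_symmetric)

lemma adj_imp_neq: "u \<rightarrow>\<^bsub>G\<^esub> v \<Longrightarrow> u \<noteq> v"
  using adj_not_same by auto

lemma card_nbhd_ge: "v \<in> verts G \<Longrightarrow> min_degree G \<le> card (nbhd G v)"
  using min_degree_le_out_degree by (simp add: out_degree_eq_card_nbhd)

lemma disjoint_nbhd_of_adj:
  assumes "girth G \<ge> 5" "u \<rightarrow>\<^bsub>G\<^esub> v"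
  shows "nbhd G u \<inter> nbhd G v = {}"
proof (rule ccontr)
  assume "nbhd G u \<inter> nbhd G v \<noteq> {}"
  then obtain w where w: "u \<rightarrow>\<^bsub>G\<^esub> w" "v \<rightarrow>\<^bsub>G\<^esub> w" by auto
  then have "girth G \<le> 3"
    using assms adj_imp_neq by (intro girth_le_3_of_triangle[of u v w]) (auto intro: adj_sym)
  with assms(1) have "(5::enat) \<le> 3" by (rule order_trans)
  then show False by simp
qed

lemma card_common_nbhd_le_1:
  assumes "girth G \<ge> 5" "u \<noteq> v"
  shows "card (nbhd G u \<inter> nbhd G v) \<le> 1"
proof -
  have "a = b" if "u \<rightarrow>\<^bsub>G\<^esub> a" "v \<rightarrow>\<^bsub>G\<^esub> a" "u \<rightarrow>\<^bsub>G\<^esub> b" "v \<rightarrow>\<^bsub>G\<^esub> b" for a b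
  proof (rule ccontr)
    \<comment> \<open>Two common neighbours give the 4-cycle \<open>u, a, v, b\<close>, with
      \<open>u\<close> and \<open>v\<close> at opposite corners.\<close>
    assume "a \<noteq> b"
    then have "girth G \<le> 4"
      using that assms(2) adj_imp_neq
      by (intro girth_le_4_of_quadrilateral[of u a v b]) (auto intro: adj_sym)
    with assms(1) have "(5::enat) \<le> 4" by (rule order_trans)
    then show False by simp
  qed
  then show ?thesis
    by (auto simp: card_le_Suc0_iff_eq)
qed

lemma card_closed_nbhd_Un_ge:
  assumes "girth G \<ge> 5" "u \<in> verts G" "v \<in> verts G" "u \<noteq> v"
  shows "2 * min_degree G \<le> card (insert u (nbhd G u) \<union> insert v (nbhd G v))"
proof -
  let ?U = "nbhd G u \<union> nbhd G v"
  have sum: "2 * min_degree G \<le> card ?U + card (nbhd G u \<inter> nbhd G v)"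
    using card_nbhd_ge[of u] card_nbhd_ge[of v] assms(2,3)
      card_Un_Int[of "nbhd G u" "nbhd G v"] by simp
  have eq: "insert u (nbhd G u) \<union> insert v (nbhd G v) = insert u (insert v ?U)"
    by auto
  show ?thesis
  proof (cases "u \<rightarrow>\<^bsub>G\<^esub> v")
    case True
    then have "2 * min_degree G \<le> card ?U"
      using sum disjoint_nbhd_of_adj assms(1) by simp
    also have "\<dots> \<le> card (insert u (insert v ?U))"
      by (intro card_mono) auto
    finally show ?thesis unfolding eq .
  next
    \<comment> \<open>Now neither \<open>u\<close> nor \<open>v\<close> lies in \<open>?U\<close>,
      so adding them gains 2, while a common neighbour costs at most 1.\<close>
    case False
    then have "card (insert u (insert v ?U)) = card ?U + 2"
      using assms(4) adj_sym[of v u] adj_not_same by (auto simp: card_insert_if)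
    then show ?thesis
      unfolding eq using sum card_common_nbhd_le_1[OF assms(1,4)] by simp
  qed
qed

text \<open>Positive minimum degree yields an edge, whose two ends supply the pair of vertices for
  the estimate. This serves the cases with fewer than two forces.\<close>

lemma card_verts_ge:
  assumes "girth G \<ge> 5" "verts G \<noteq> {}" "min_degree G > 0"
  shows "2 * min_degree G \<le> card (verts G)"
proof -
  obtain u where u: "u \<in> verts G" using assms(2) by auto
  with assms(3) card_nbhd_ge have "nbhd G u \<noteq> {}" by fastforce
  then obtain v where "u \<rightarrow>\<^bsub>G\<^esub> v" by auto
  then have v: "v \<in> verts G" "u \<noteq> v" using adj_in_verts adj_imp_neq by auto
  have "2 * min_degree G \<le> card (insert u (nbhd G u) \<union> insert v (nbhd G v))"
    using assms(1) u v by (rule card_closed_nbhd_Un_ge)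
  also have "\<dots> \<le> card (verts G)"
    using u v nbhd_subset_verts by (intro card_mono) auto
  finally show ?thesis .
qed

lemma card_zero_forcing_set_ge:
  assumes "girth G \<ge> 5" "verts G \<noteq> {}" "min_degree G > 0" "zero_forcing_set G S"
  shows "2 * min_degree G \<le> card S + 2"
proof -
  have S: "S \<subseteq> verts G" and steps: "(force_step G)\<^sup>*\<^sup>* S (verts G)"
    using assms(4) by (auto simp: zero_forcing_set_def)
  have fin: "finite S" using S finite_verts by (rule finite_subset)
  have V: "2 * min_degree G \<le> card (verts G)"
    using assms(1-3) by (rule card_verts_ge)
  \<comment> \<open>Only the first two forces are peeled off; the rest of the process does not enter
    the count.\<close>
  from steps show ?thesis
  proof (cases rule: converse_rtranclpE)
    case base
    with V show ?thesis by simp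
  next
    case (step T)
    then obtain v w where vw: "forces G S v w" and T: "T = insert w S"
      by (auto simp: force_step_def)
    from \<open>(force_step G)\<^sup>*\<^sup>* T (verts G)\<close> show ?thesis
    proof (cases rule: converse_rtranclpE)
      case base
      with V T fin show ?thesis by (simp add: card_insert_if split: if_splits)
    next
      case (step U)
      then obtain v' w' where vw': "forces G T v' w'"
        by (auto simp: force_step_def)
      have N: "v \<in> S" "nbhd G v \<subseteq> T" "v \<in> verts G"
        using vw T S by (auto simp: forces_iff)
      have "v' \<rightarrow>\<^bsub>G\<^esub> w'" "w' \<notin> T" and N': "v' \<in> T" "nbhd G v' \<subseteq> insert w' T"
        using vw' by (simp_all add: forces_iff)
      \<comment> \<open>After its force \<open>v\<close> has all its neighbours in \<open>T\<close>,
        whereas \<open>v'\<close> still has the neighbour \<open>w'\<close> outside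
        \<open>T\<close>.\<close>
      with N have "v \<noteq> v'" "v' \<in> verts G"
        using adj_in_verts by auto
      with assms(1) N have
        "2 * min_degree G \<le> card (insert v (nbhd G v) \<union> insert v' (nbhd G v'))"
        by (intro card_closed_nbhd_Un_ge) auto
      \<comment> \<open>Both forcing vertices are already in \<open>T = insert w S\<close>, so only
        \<open>w'\<close> has to be added.\<close>
      also have "\<dots> \<le> card (insert w' (insert w S))"
        using N N' T fin by (intro card_mono) auto
      also have "\<dots> \<le> card S + 2"
        using fin by (simp add: card_insert_if)
      finally show ?thesis .
    qed
  qed
qed

end

theorem theorem3:
  fixes G :: "('a, 'b) pre_digraph"
  assumes "graph G"
    and "verts G \<noteq> {}"
    and "girth G \<ge> 5"
    and "min_degree G \<ge> 2"
  shows "2 * min_degree G - 2 \<le> zero_forcing_number G"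
proof -
  interpret graph G by fact
  show ?thesis
  proof (rule zero_forcing_number_geI)
    fix S
    assume "zero_forcing_set G S"
    with assms card_zero_forcing_set_ge[of S] show "2 * min_degree G - 2 \<le> card S"
      by simp
  qed
qed

end
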